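(* Let $d\geq 3$, let $N=\mathbb{Z}^d$ and $N_{\mathbb{R}}=\mathbb{R}^d$, and let $\sigma\subseteq N_{\mathbb{R}}$ be the $d$-dimensional cone generated by $$(1,0,\ldots,0),\ (0,1,0,\ldots,0),\ \ldots,\ (0,\ldots,0,1,0),\ (a_1,a_2,\ldots,a_d),$$ i.e. by the first $d-1$ standard basis vectors together with $(a_1,\ldots,a_d)$, where $a_1,a_2,\ldots,a_d\in\mathbb{Z}$, $a_1\leq a_2\leq\cdots\leq a_{d-1}<a_d$ and $1\leq a_1\leq d-2$. Then the affine toric variety $X_\sigma$ associated to $\sigma$ does not admit a moderate toric resolution; that is, there is no moderate toric resolution $\Sigma$ of $\sigma$.
   Context: Let $M$ and $N$ be free abelian groups of rank $d$ dual to each other, $N_{\mathbb{R}}=N\otimes\mathbb{R}$, $M_{\mathbb{R}}=M\otimes\mathbb{R}$, and $k$ an arbitrary field. A cone in $N_{\mathbb{R}}$ means a strongly convex, rational polyhedral cone. It is nondegenerate if it is $d$-dimensional. For a cone $\sigma$ with dual cone $\sigma^\vee\subseteq M_{\mathbb{R}}$, $X_\sigma=\operatorname{Spec} k[\sigma^\vee\cap M]$; for a fan $\Sigma$, $X_\Sigma$ is the associated toric variety. Each one-dimensional cone $\rho$ contains a unique primitive element $P(\rho)\in\rho\cap N$ (so $\rho=\mathbb{R}_{\geq 0}P(\rho)$); $\operatorname{Gen}(\tau)$ denotes the set of the $P(\rho)$ for $\rho$ the one-dimensional faces of a cone $\tau$ (the minimal generators of $\tau$). A cone is smooth if its minimal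 generators form part of a $\mathbb{Z}$-basis of $N$. A subdivision of $\sigma$ is a (finite) fan whose support is $\sigma$. Moderate toric resolution: a subdivision $\Sigma$ of a nondegenerate cone $\sigma\subseteq N_{\mathbb{R}}$ is a moderate toric resolution of $\sigma$ if every nondegenerate cone $\tau$ of $\Sigma$ is smooth and the affine hyperplane $\{x\in N_{\mathbb{R}}\mid l_\tau(x)=1\}$ spanned by $\operatorname{Gen}(\tau)$ intersects every one-dimensional face of $\sigma$, where $l_\tau:N_{\mathbb{R}}\to\mathbb{R}$ is the linear function sending each minimal generator of $\tau$ to $1$. The induced morphism $X_\Sigma\to X_\sigma$ is also called a moderate toric resolution. *)

theory Defs
  imports "HOL-Analysis.Analysis"
begin

text \<open>Throughout, N is the standard lattice of integer vectors in \<open>real ^ 'n\<close>, and \<open>d = CARD('n)\<close>.\<close>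

definition lattice :: "(real ^ 'n) set" where
  "lattice = {x. \<forall>i. x $ i \<in> \<int>}"

definition rational_cone :: "(real ^ 'n) set \<Rightarrow> bool" where
  "rational_cone \<sigma> \<longleftrightarrow>
     (\<exists>S. finite S \<and> S \<subseteq> lattice \<and> \<sigma> = convex_cone hull S) \<and>
     (\<forall>x. x \<in> \<sigma> \<and> - x \<in> \<sigma> \<longrightarrow> x = 0)"

definition nondegenerate :: "(real ^ 'n) set \<Rightarrow> bool" where
  "nondegenerate \<sigma> \<longleftrightarrow> dim \<sigma> = CARD('n)"

text \<open>The convex-geometric \<^const>\<open>face_of\<close> also admits the empty set, which is not a face of a cone.
  Lemma \<open>cone_face_iff_supporting\<close> below recovers the description of the faces
  as the sets on which some element of the dual cone vanishes.\<close>

definition cone_face :: "(real ^ 'n) set \<Rightarrow> (real ^ 'n) set \<Rightarrow> bool" where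
  "cone_face \<tau> \<sigma> \<longleftrightarrow> \<tau> face_of \<sigma> \<and> \<tau> \<noteq> {}"

definition rays :: "(real ^ 'n) set \<Rightarrow> (real ^ 'n) set set" where
  "rays \<sigma> = {\<rho>. cone_face \<rho> \<sigma> \<and> dim \<rho> = 1}"

definition primitive :: "real ^ 'n \<Rightarrow> bool" where
  "primitive v \<longleftrightarrow> v \<in> lattice \<and> v \<noteq> 0 \<and>
     (\<forall>w\<in>lattice. \<forall>m::int. v = of_int m *\<^sub>R w \<longrightarrow> \<bar>m\<bar> = 1)"

text \<open>The description picks out a unique vector when \<open>\<rho>\<close> is a one-dimensional
  \<^const>\<open>rational_cone\<close>; it is only applied to such \<open>\<rho>\<close>.\<close>

definition prim_gen :: "(real ^ 'n) set \<Rightarrow> real ^ 'n" where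
  "prim_gen \<rho> = (THE v. v \<in> \<rho> \<and> primitive v)"

definition Gen :: "(real ^ 'n) set \<Rightarrow> (real ^ 'n) set" where
  "Gen \<tau> = prim_gen ` rays \<tau>"

definition lattice_basis :: "(real ^ 'n) set \<Rightarrow> bool" where
  "lattice_basis B \<longleftrightarrow> finite B \<and> B \<subseteq> lattice \<and>
     (\<forall>x\<in>lattice. \<exists>!c :: real ^ 'n \<Rightarrow> int.
        (\<forall>b. b \<notin> B \<longrightarrow> c b = 0) \<and> x = (\<Sum>b\<in>B. of_int (c b) *\<^sub>R b))"

definition smooth_cone :: "(real ^ 'n) set \<Rightarrow> bool" where
  "smooth_cone \<tau> \<longleftrightarrow> (\<exists>B. lattice_basis B \<and> Gen \<tau> \<subseteq> B)"

definition fan :: "(real ^ 'n) set set \<Rightarrow> bool" where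
  "fan \<Sigma> \<longleftrightarrow> finite \<Sigma> \<and> (\<forall>\<tau>\<in>\<Sigma>. rational_cone \<tau>) \<and>
     (\<forall>\<tau>\<in>\<Sigma>. \<forall>\<gamma>. cone_face \<gamma> \<tau> \<longrightarrow> \<gamma> \<in> \<Sigma>) \<and>
     (\<forall>\<tau>\<in>\<Sigma>. \<forall>\<gamma>\<in>\<Sigma>. cone_face (\<tau> \<inter> \<gamma>) \<tau> \<and> cone_face (\<tau> \<inter> \<gamma>) \<gamma>)"

definition subdivision :: "(real ^ 'n) set \<Rightarrow> (real ^ 'n) set set \<Rightarrow> bool" where
  "subdivision \<sigma> \<Sigma> \<longleftrightarrow> fan \<Sigma> \<and> \<Union>\<Sigma> = \<sigma>"

text \<open>The function \<open>l\<^sub>\<tau>\<close> is determined by its defining condition when \<open>\<tau>\<close> is nondegenerate and smooth.\<close>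

definition gen_functional :: "(real ^ 'n) set \<Rightarrow> real ^ 'n \<Rightarrow> real" where
  "gen_functional \<tau> = (THE l. linear l \<and> (\<forall>v\<in>Gen \<tau>. l v = 1))"

definition moderate_toric_resolution :: "(real ^ 'n) set \<Rightarrow> (real ^ 'n) set set \<Rightarrow> bool" where
  "moderate_toric_resolution \<sigma> \<Sigma> \<longleftrightarrow> subdivision \<sigma> \<Sigma> \<and>
     (\<forall>\<tau>\<in>\<Sigma>. nondegenerate \<tau> \<longrightarrow> smooth_cone \<tau> \<and>
        (\<forall>\<rho>\<in>rays \<sigma>. {x. gen_functional \<tau> x = 1} \<inter> \<rho> \<noteq> {}))"

lemma cone_face_iff_supporting:
  fixes \<sigma> :: "(real ^ 'n) set"
  assumes "rational_cone \<sigma>"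
  shows "cone_face \<tau> \<sigma> \<longleftrightarrow> (\<exists>u. (\<forall>x\<in>\<sigma>. 0 \<le> u \<bullet> x) \<and> \<tau> = {x \<in> \<sigma>. u \<bullet> x = 0})"
proof -
  obtain S where S: "finite S" "\<sigma> = convex_cone hull S"
    using assms by (auto simp: rational_cone_def)
  have poly: "polyhedron \<sigma>"
    using S polyhedron_convex_cone_hull by blast
  have con: "conic \<sigma>" and cvx: "convex \<sigma>" and zero: "0 \<in> \<sigma>"
    using S conic_convex_cone_hull convex_convex_cone_hull convex_cone_hull_contains_0 by auto
  show ?thesis
  proof
    assume "cone_face \<tau> \<sigma>"
    then have "\<tau> exposed_face_of \<sigma>" and ne: "\<tau> \<noteq> {}"
      using exposed_face_of_polyhedron[OF poly] by (auto simp: cone_face_def)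
    then obtain a b where ab: "\<sigma> \<subseteq> {x. a \<bullet> x \<le> b}" "\<tau> = \<sigma> \<inter> {x. a \<bullet> x = b}"
      by (auto simp: exposed_face_of_def)
    obtain y where y: "y \<in> \<sigma>" "a \<bullet> y = b" using ne ab by auto
    have "0 \<le> b" using ab zero by force
    moreover have "2 *\<^sub>R y \<in> \<sigma>" using con y by (simp add: conicD)
    then have "2 * b \<le> b" using ab y by force
    ultimately have "b = 0" by simp
    then have "(\<forall>x\<in>\<sigma>. 0 \<le> (- a) \<bullet> x) \<and> \<tau> = {x \<in> \<sigma>. (- a) \<bullet> x = 0}"
      using ab by auto
    then show "\<exists>u. (\<forall>x\<in>\<sigma>. 0 \<le> u \<bullet> x) \<and> \<tau> = {x \<in> \<sigma>. u \<bullet> x = 0}" by blast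
  next
    assume "\<exists>u. (\<forall>x\<in>\<sigma>. 0 \<le> u \<bullet> x) \<and> \<tau> = {x \<in> \<sigma>. u \<bullet> x = 0}"
    then obtain u where u: "\<forall>x\<in>\<sigma>. 0 \<le> u \<bullet> x" "\<tau> = {x \<in> \<sigma>. u \<bullet> x = 0}" by blast
    have "\<sigma> \<inter> {x. u \<bullet> x = 0} face_of \<sigma>"
      using face_of_Int_supporting_hyperplane_ge[OF cvx] u by blast
    moreover have "\<tau> = \<sigma> \<inter> {x. u \<bullet> x = 0}" "0 \<in> \<tau>" using u zero by auto
    ultimately show "cone_face \<tau> \<sigma>" by (auto simp: cone_face_def)
  qed
qed

end

theory Submission
  imports Defs
begin

text \<open>
  The facet of \<open>\<sigma>\<close> spanned by the first \<open>d - 1\<close> standard basis vectors determines what a moderate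
  resolution \<open>\<Sigma>\<close> has to look like next to it, and the neighbouring cone then fails the
  condition at the remaining ray, the one through \<open>v = (a\<^sub>1, \<dots>, a\<^sub>d)\<close>.

  Let \<open>s = (1, \<dots>, 1, 0)\<close>, a point in the middle of that facet.  The lower-dimensional cones of
  \<open>\<Sigma>\<close> are negligible and there are finitely many cones, all closed, so some nondegenerate
  \<open>\<tau> \<in> \<Sigma>\<close> contains \<open>s\<close> (\<open>subdivision_nondegenerate_cover\<close>).  Since \<open>\<tau>\<close> is smooth, its
  generators form a lattice basis \<open>B\<close>, and they generate \<open>\<tau>\<close>
  (\<open>nondegenerate_smooth_cone\<close>).  Hence \<open>l = l\<^sub>\<tau>\<close> takes integer values on the lattice.
  A linear function that attains the value 1 on a ray is positive on its nonzero points, so moderateness gives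
  \<open>l e\<^sub>i \<ge> 1\<close> for \<open>i < d\<close>, and \<open>l v > 0\<close>.

  An element \<open>b\<close> of \<open>B\<close> that occurs in the expansion of \<open>s\<close> lies on the facet, so it is a
  combination of the \<open>e\<^sub>i\<close> with natural coefficients; as \<open>l b = 1\<close> and \<open>l e\<^sub>i \<ge> 1\<close>, it must be one
  of the \<open>e\<^sub>i\<close>.  Since the first \<open>d - 1\<close> coordinates of \<open>s\<close> are positive, each of these \<open>e\<^sub>i\<close> occurs
  and hence belongs to \<open>B\<close>
  (\<open>facet_generators\<close>).  The one further element \<open>b\<close> of \<open>B\<close> completes them to a lattice basis,
  so its last coordinate is 1, and membership in \<open>\<sigma>\<close> makes its other coordinates positive
  integers.  From \<open>l b = 1\<close> follows \<open>l e\<^sub>d \<le> 2 - d\<close>, and therefore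
  \<open>l v \<le> a\<^sub>1 + \<dots> + a\<^sub>d\<^sub>-\<^sub>1 - (d - 2) a\<^sub>d\<close>.
  The assumptions on the \<open>a\<^sub>i\<close> enter through the estimate
  \<open>a\<^sub>1 + \<dots> + a\<^sub>d\<^sub>-\<^sub>1 \<le> (d - 2) + (d - 2) (a\<^sub>d - 1) = (d - 2) a\<^sub>d\<close>, which contradicts \<open>l v > 0\<close>.
\<close>

section \<open>Lattice points and coordinates\<close>

lemma lattice_diff: "x \<in> lattice \<Longrightarrow> y \<in> lattice \<Longrightarrow> x - y \<in> lattice"
  by (simp add: lattice_def)

lemma lattice_scale_int: "x \<in> lattice \<Longrightarrow> of_int m *\<^sub>R x \<in> lattice"
  by (simp add: lattice_def)

lemma axis_in_lattice: "axis i 1 \<in> lattice"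
  by (simp add: lattice_def axis_def)

lemma axis_expansion: "(\<Sum>i\<in>UNIV. x $ i *\<^sub>R axis i 1) = (x :: real ^ 'n)"
  using basis_expansion[of x] by (simp add: scalar_mult_eq_scaleR)

lemma linear_axis_expansion:
  fixes f :: "real ^ 'n \<Rightarrow> real"
  assumes "linear f"
  shows "f x = (\<Sum>i\<in>UNIV. x $ i * f (axis i 1))"
proof -
  have "f x = f (\<Sum>i\<in>UNIV. x $ i *\<^sub>R axis i 1)" by (simp only: axis_expansion)
  then show ?thesis by (simp only: linear_sum[OF assms] linear_scale[OF assms] real_scaleR_def)
qed

lemma sum_UNIV_split_off:
  fixes g :: "'a::finite \<Rightarrow> 'b::comm_monoid_add"
  shows "(\<Sum>j\<in>UNIV. g j) = g i + (\<Sum>j\<in>- {i}. g j)"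
  using sum.remove[of UNIV i g] by (simp only: Compl_eq_Diff_UNIV finite UNIV_I)

lemma integral_lower_bound:
  fixes x :: real
  assumes "x \<in> \<int>" "0 < x"
  shows "1 \<le> x"
proof -
  obtain m where "x = of_int m" using assms(1) by (rule Ints_cases)
  then show ?thesis using assms(2) by simp
qed

section \<open>Rays and their primitive lattice points\<close>

definition ray :: "real ^ 'n \<Rightarrow> (real ^ 'n) set" where
  "ray s = (\<lambda>t. t *\<^sub>R s) ` {0..}"

text \<open>
  This is the division algorithm on a ray: take \<open>w\<close> to be a nonzero lattice point of smallest size,
  measured by a coordinate \<open>j\<close> that does not vanish on the ray.  For a multiple \<open>q w\<close> in the lattice
  the remainder \<open>frac q \<cdot> w\<close> is a lattice point as well, and too small to be nonzero.
\<close>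

lemma ray_lattice_points_multiples:
  fixes s :: "real ^ 'n"
  assumes "s \<in> lattice" "s \<noteq> 0"
  obtains w where "w \<in> ray s" "w \<in> lattice" "w \<noteq> 0"
    "\<And>x. x \<in> ray s \<Longrightarrow> x \<in> lattice \<Longrightarrow> \<exists>n::int. 0 \<le> n \<and> x = of_int n *\<^sub>R w"
proof -
  obtain j where j: "s $ j \<noteq> 0" using assms(2) by (auto simp: vec_eq_iff)
  define P where "P = (\<lambda>w. w \<in> ray s \<and> w \<in> lattice \<and> w \<noteq> 0)"
  have "P s" using assms by (auto simp: P_def ray_def intro: image_eqI[of _ _ 1])
  define w where "w = (ARG_MIN (\<lambda>w. nat \<lfloor>\<bar>w $ j\<bar>\<rfloor>) w. P w)"
  have Pw: "P w" and wmin: "\<And>y. P y \<Longrightarrow> nat \<lfloor>\<bar>w $ j\<bar>\<rfloor> \<le> nat \<lfloor>\<bar>y $ j\<bar>\<rfloor>"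
    using arg_min_nat_lemma[of P s "\<lambda>w. nat \<lfloor>\<bar>w $ j\<bar>\<rfloor>"] \<open>P s\<close> by (auto simp: w_def)
  obtain t0 where t0: "0 \<le> t0" "w = t0 *\<^sub>R s" using Pw by (auto simp: P_def ray_def)
  have t0p: "0 < t0" using t0 Pw by (cases "t0 = 0") (auto simp: P_def)
  have "\<exists>n::int. 0 \<le> n \<and> x = of_int n *\<^sub>R w" if x: "x \<in> ray s" "x \<in> lattice" for x
  proof -
    obtain t where t: "0 \<le> t" "x = t *\<^sub>R s" using x by (auto simp: ray_def)
    define q where "q = t / t0"
    have q: "0 \<le> q" "x = q *\<^sub>R w" using t t0 t0p by (auto simp: q_def)
    define r where "r = frac q *\<^sub>R w"
    have r_eq: "r = x - of_int \<lfloor>q\<rfloor> *\<^sub>R w"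
      by (simp add: r_def q frac_def algebra_simps)
    have rl: "r \<in> lattice"
      unfolding r_eq using x Pw by (auto simp: P_def intro: lattice_diff lattice_scale_int)
    have rr: "r \<in> ray s"
      using t0 t0p by (auto simp: r_def ray_def intro!: image_eqI[of _ _ "frac q * t0"])
    have "r = 0"
    proof (rule ccontr)
      assume "r \<noteq> 0"
      then have "nat \<lfloor>\<bar>w $ j\<bar>\<rfloor> \<le> nat \<lfloor>\<bar>r $ j\<bar>\<rfloor>" using wmin[of r] rl rr by (simp add: P_def)
      moreover obtain m n :: int where mn: "w $ j = of_int m" "r $ j = of_int n"
        using rl Pw unfolding P_def lattice_def by (metis (no_types, lifting) Ints_cases mem_Collect_eq)
      ultimately have "\<bar>m\<bar> \<le> \<bar>n\<bar>" by (simp flip: of_int_abs)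
      then have "\<bar>w $ j\<bar> \<le> \<bar>r $ j\<bar>" by (simp add: mn flip: of_int_abs)
      also have "\<dots> = frac q * \<bar>w $ j\<bar>" by (simp add: r_def abs_mult)
      finally have "(1 - frac q) * \<bar>w $ j\<bar> \<le> 0" by (simp add: algebra_simps)
      moreover have "0 < (1 - frac q) * \<bar>w $ j\<bar>"
        using frac_lt_1[of q] j t0 t0p by (intro mult_pos_pos) auto
      ultimately show False by simp
    qed
    then show ?thesis using r_eq q(1) by (intro exI[of _ "\<lfloor>q\<rfloor>"]) auto
  qed
  then show ?thesis using that Pw by (auto simp: P_def)
qed

text \<open>This makes the description defining \<^const>\<open>prim_gen\<close> meaningful on rational rays.\<close>

lemma ex1_primitive_in_ray:
  fixes s :: "real ^ 'n"
  assumes "s \<in> lattice" "s \<noteq> 0"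
  shows "\<exists>!v. v \<in> ray s \<and> primitive v"
proof -
  obtain w where w: "w \<in> ray s" "w \<in> lattice" "w \<noteq> 0"
    and mult: "\<And>x. x \<in> ray s \<Longrightarrow> x \<in> lattice \<Longrightarrow> \<exists>n::int. 0 \<le> n \<and> x = of_int n *\<^sub>R w"
    using ray_lattice_points_multiples[OF assms] by blast
  obtain t where t: "0 \<le> t" "w = t *\<^sub>R s" using w by (auto simp: ray_def)
  have "primitive w"
    unfolding primitive_def
  proof (intro conjI ballI allI impI)
    fix u and m :: int
    assume u: "u \<in> lattice" "w = of_int m *\<^sub>R u"
    have m0: "m \<noteq> 0" using u w by auto
    have eq: "of_int (sgn m) *\<^sub>R u = (1 / \<bar>of_int m\<bar>) *\<^sub>R w"
      using m0 by (simp add: u(2) sgn_if)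
    have "of_int (sgn m) *\<^sub>R u \<in> ray s"
      unfolding eq t(2) ray_def using t(1) by (auto intro!: image_eqI[of _ _ "t / \<bar>of_int m\<bar>"])
    from mult[OF this lattice_scale_int[OF u(1)]]
    obtain n :: int where "(1 / \<bar>of_int m\<bar>) *\<^sub>R w = of_int n *\<^sub>R w" unfolding eq by blast
    then have "1 / \<bar>of_int m\<bar> = (of_int n :: real)" using w(3) by simp
    then have "(of_int (n * \<bar>m\<bar>) :: real) = of_int 1" using m0 by (simp add: field_simps)
    then have "n * \<bar>m\<bar> = 1" using of_int_eq_iff by blast
    then show "\<bar>m\<bar> = 1"
      by (metis abs_ge_zero mult.commute pos_zmult_eq_1_iff zero_less_abs_iff m0)
  qed (use w in auto)
  moreover have "v = w" if v: "v \<in> ray s" "primitive v" for v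
  proof -
    obtain n :: int where "0 \<le> n" "v = of_int n *\<^sub>R w"
      using mult[of v] v unfolding primitive_def by blast
    moreover from this have "\<bar>n\<bar> = 1" using v w by (auto simp: primitive_def)
    ultimately show ?thesis by auto
  qed
  ultimately show ?thesis using w by blast
qed

section \<open>A rational cone is generated by its minimal generators\<close>

lemma convex_cone_hull_insert:
  assumes "x \<in> convex_cone hull insert s S"
  obtains t y where "0 \<le> t" "y \<in> convex_cone hull S" "x = t *\<^sub>R s + y"
proof -
  have "convex_cone hull {s} \<subseteq> (\<lambda>t. t *\<^sub>R s) ` {0..}"
  proof (rule hull_minimal)
    show "{s} \<subseteq> (\<lambda>t. t *\<^sub>R s) ` {0..}" by (auto intro: image_eqI[of _ _ 1])
    show "convex_cone ((\<lambda>t. t *\<^sub>R s) ` {0..})"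
      unfolding convex_cone_iff
    proof (intro conjI ballI allI impI)
      fix x y assume "x \<in> (\<lambda>t. t *\<^sub>R s) ` {0..}" "y \<in> (\<lambda>t. t *\<^sub>R s) ` {0..}"
      then show "x + y \<in> (\<lambda>t. t *\<^sub>R s) ` {0..}" by (auto simp flip: scaleR_add_left)
    qed auto
  qed
  moreover have "insert s S = {s} \<union> S" by simp
  ultimately show ?thesis
    using assms that unfolding \<open>insert s S = {s} \<union> S\<close> convex_cone_hull_Un by blast
qed

lemma dim_ray: "s \<noteq> 0 \<Longrightarrow> dim (ray s) = 1"
proof -
  assume "s \<noteq> 0"
  have "span (ray s) = span {s}"
  proof (rule span_eq[THEN iffD2], intro conjI)
    show "ray s \<subseteq> span {s}" by (auto simp: ray_def span_base span_scale)
    show "{s} \<subseteq> span (ray s)" by (auto simp: ray_def intro!: span_base image_eqI[of _ _ 1])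
  qed
  then have "dim (ray s) = dim {s}" by (metis dim_span)
  then show ?thesis using \<open>s \<noteq> 0\<close> by simp
qed

text \<open>
  Suppose a point \<open>t s\<close> of the ray is a positive combination of \<open>p\<close> and \<open>q\<close> in the cone.  Splitting
  off the multiples of \<open>s\<close> in \<open>p\<close> and \<open>q\<close> leaves a positive combination of elements \<open>p'\<close> and \<open>q'\<close> of
  \<open>convex_cone hull S\<close> that equals \<open>r s\<close> for some \<open>r\<close>.  If \<open>r > 0\<close> then \<open>s\<close> would be redundant;
  if \<open>r \<le> 0\<close> then \<open>- p'\<close> lies in the cone, and pointedness forces \<open>p' = 0\<close>.
\<close>

lemma irredundant_generator_ray:
  fixes s :: "real ^ 'n"
  assumes pointed: "\<And>x. x \<in> convex_cone hull insert s S \<Longrightarrow> - x \<in> convex_cone hull insert s S \<Longrightarrow> x = 0"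
    and irr: "s \<notin> convex_cone hull S"
  shows "ray s \<in> rays (convex_cone hull insert s S)"
proof -
  let ?T = "convex_cone hull insert s S" and ?C = "convex_cone hull S"
  have CT: "?C \<subseteq> ?T" by (rule hull_mono) auto
  have sT: "s \<in> ?T" by (simp add: hull_inc)
  have s0: "s \<noteq> 0" using irr convex_cone_hull_contains_0 by auto
  have end_in_ray: "p \<in> ray s"
    if p: "p \<in> ?T" and q: "q \<in> ?T" and lam: "0 < lam" "0 < mu"
      and eq: "lam *\<^sub>R p + mu *\<^sub>R q = t *\<^sub>R s" for p q t lam mu
  proof -
    obtain a p' where p': "0 \<le> a" "p' \<in> ?C" "p = a *\<^sub>R s + p'"
      using convex_cone_hull_insert[OF p] .
    obtain b q' where q': "0 \<le> b" "q' \<in> ?C" "q = b *\<^sub>R s + q'"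
      using convex_cone_hull_insert[OF q] .
    define r where "r = t - lam * a - mu * b"
    have sum_eq: "lam *\<^sub>R p' + mu *\<^sub>R q' = r *\<^sub>R s"
      using eq by (simp add: p'(3) q'(3) r_def algebra_simps)
    have "r \<le> 0"
    proof (rule ccontr)
      assume "\<not> r \<le> 0"
      then have "s = (1 / r) *\<^sub>R (lam *\<^sub>R p' + mu *\<^sub>R q')" by (simp add: sum_eq)
      moreover have "(1 / r) *\<^sub>R (lam *\<^sub>R p' + mu *\<^sub>R q') \<in> ?C"
        using \<open>\<not> r \<le> 0\<close> lam p' q'
        by (intro convex_cone_hull_mul convex_cone_hull_add) auto
      ultimately show False using irr by simp
    qed
    have "- (lam *\<^sub>R p') = mu *\<^sub>R q' + (- r) *\<^sub>R s" using sum_eq by (simp add: algebra_simps)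
    moreover have "mu *\<^sub>R q' + (- r) *\<^sub>R s \<in> ?T"
      using \<open>r \<le> 0\<close> lam q' CT sT by (intro convex_cone_hull_mul convex_cone_hull_add) auto
    moreover have "lam *\<^sub>R p' \<in> ?T" using lam p' CT by (intro convex_cone_hull_mul) auto
    ultimately have "lam *\<^sub>R p' = 0" using pointed by metis
    then show ?thesis using lam p' by (auto simp: ray_def)
  qed
  have "ray s face_of ?T"
    unfolding face_of_def
  proof (intro conjI ballI impI)
    show "ray s \<subseteq> ?T" using sT by (auto simp: ray_def intro: convex_cone_hull_mul)
    show "convex (ray s)"
      unfolding ray_def by (intro convex_linear_image) (auto simp: linear_iff algebra_simps)
  next
    fix p q x assume pq: "p \<in> ?T" "q \<in> ?T" and "x \<in> ray s" "x \<in> open_segment p q"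
    then obtain t u where "x = t *\<^sub>R s" and u: "0 < u" "u < 1" "x = (1 - u) *\<^sub>R p + u *\<^sub>R q"
      unfolding in_segment ray_def by blast
    then have eq: "(1 - u) *\<^sub>R p + u *\<^sub>R q = t *\<^sub>R s" by simp
    show "p \<in> ray s" using end_in_ray[OF pq _ _ eq] u by auto
    show "q \<in> ray s" using end_in_ray[OF pq(2,1), of u "1 - u" t] eq u by (auto simp: add.commute)
  qed
  then show ?thesis using dim_ray[OF s0] by (auto simp: rays_def cone_face_def ray_def)
qed

text \<open>
  In a generating set of smallest cardinality every element is irredundant, hence spans an extreme
  ray and may be replaced by the primitive point of that ray.  That \<open>G\<close> is only claimed to be a
  subset of \<open>Gen \<tau>\<close> saves the converse, that every one-dimensional face arises in this way; for
  smooth cones the equality follows from linear independence.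
\<close>

lemma rational_cone_generated_by_Gen:
  fixes \<tau> :: "(real ^ 'n) set"
  assumes "rational_cone \<tau>"
  obtains G where "G \<subseteq> Gen \<tau>" "\<tau> = convex_cone hull G"
proof -
  obtain S0 where S0: "finite S0" "S0 \<subseteq> lattice" "\<tau> = convex_cone hull S0"
    and pointed: "\<And>x. x \<in> \<tau> \<Longrightarrow> - x \<in> \<tau> \<Longrightarrow> x = 0"
    using assms by (auto simp: rational_cone_def)
  define P where "P = (\<lambda>S. S \<subseteq> S0 \<and> \<tau> = convex_cone hull S)"
  have "P S0" using S0 by (simp add: P_def)
  define S where "S = (ARG_MIN card S. P S)"
  have PS: "P S" and Smin: "\<And>S'. P S' \<Longrightarrow> card S \<le> card S'"
    using arg_min_nat_lemma[of P S0 card] \<open>P S0\<close> by (auto simp: S_def)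
  have finS: "finite S" using PS S0 finite_subset by (auto simp: P_def)
  have irr: "s \<notin> convex_cone hull (S - {s})" if "s \<in> S" for s
  proof
    assume "s \<in> convex_cone hull (S - {s})"
    then have "convex_cone hull (S - {s}) = \<tau>"
      using PS that hull_redundant[of s convex_cone "S - {s}"] by (auto simp: P_def insert_absorb)
    then have "card S \<le> card (S - {s})" using Smin[of "S - {s}"] PS by (auto simp: P_def)
    then show False using finS that by (metis card_Diff1_less not_less)
  qed
  have s: "prim_gen (ray s) \<in> Gen \<tau> \<and> (\<exists>c>0. prim_gen (ray s) = c *\<^sub>R s)" if "s \<in> S" for s
  proof -
    have ins: "\<tau> = convex_cone hull insert s (S - {s})"
      using PS that by (auto simp: P_def insert_absorb)
    have "ray s \<in> rays \<tau>"
      unfolding ins by (rule irredundant_generator_ray[OF _ irr[OF that]]) (use pointed ins in auto)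
    moreover have "s \<noteq> 0" using irr[OF that] convex_cone_hull_contains_0 by auto
    moreover have "s \<in> lattice" using that PS S0 by (auto simp: P_def)
    ultimately have "prim_gen (ray s) \<in> ray s \<and> primitive (prim_gen (ray s))"
      unfolding prim_gen_def using theI'[OF ex1_primitive_in_ray] by blast
    then obtain c where "0 \<le> c" "prim_gen (ray s) = c *\<^sub>R s" "c *\<^sub>R s \<noteq> 0"
      by (auto simp: ray_def primitive_def)
    moreover have "prim_gen (ray s) \<in> Gen \<tau>" using \<open>ray s \<in> rays \<tau>\<close> by (simp add: Gen_def)
    ultimately show ?thesis by (auto intro!: exI[of _ c])
  qed
  let ?G = "(\<lambda>s. prim_gen (ray s)) ` S"
  have "convex_cone hull S \<subseteq> convex_cone hull ?G"
  proof (intro hull_minimal convex_cone_convex_cone_hull subsetI)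
    fix x assume "x \<in> S"
    then obtain c where c: "0 < c" "prim_gen (ray x) = c *\<^sub>R x" using s by blast
    have "prim_gen (ray x) \<in> ?G" using \<open>x \<in> S\<close> by (rule imageI)
    then have "(1 / c) *\<^sub>R prim_gen (ray x) \<in> convex_cone hull ?G"
      using c(1) by (intro convex_cone_hull_mul hull_inc) auto
    then show "x \<in> convex_cone hull ?G" using c by simp
  qed
  moreover have "convex_cone hull ?G \<subseteq> convex_cone hull S"
  proof (intro hull_minimal convex_cone_convex_cone_hull image_subsetI)
    fix x assume "x \<in> S"
    then obtain c where c: "0 < c" "prim_gen (ray x) = c *\<^sub>R x" using s by blast
    then show "prim_gen (ray x) \<in> convex_cone hull S"
      using \<open>x \<in> S\<close> by (auto intro: convex_cone_hull_mul hull_inc)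
  qed
  ultimately show ?thesis using that[of ?G] s PS by (auto simp: P_def)
qed

section \<open>Nondegenerate smooth cones\<close>

text \<open>
  A lattice basis is defined through integer combinations only; the dual basis provides its
  linear independence over the reals.  The functional \<open>f b\<close> is obtained by extending linearly the
  integer coefficients at \<open>b\<close> of the standard basis vectors, and uniqueness of integer
  coefficients identifies its values on \<open>B\<close>.
\<close>

lemma lattice_basis_dual:
  fixes B :: "(real ^ 'n) set"
  assumes "lattice_basis B"
  obtains f :: "real ^ 'n \<Rightarrow> real ^ 'n \<Rightarrow> real" where
    "\<forall>b. linear (f b)" "\<forall>b. \<forall>x\<in>lattice. f b x \<in> \<int>"
    "\<forall>b\<in>B. \<forall>b'\<in>B. f b b' = (if b = b' then 1 else 0)"
    "\<forall>x. (\<Sum>b\<in>B. f b x *\<^sub>R b) = x"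
proof -
  have fin: "finite B" and BL: "B \<subseteq> lattice"
    and ex1: "\<And>x. x \<in> lattice \<Longrightarrow> \<exists>!c :: real ^ 'n \<Rightarrow> int.
        (\<forall>b. b \<notin> B \<longrightarrow> c b = 0) \<and> x = (\<Sum>b\<in>B. of_int (c b) *\<^sub>R b)"
    using assms by (auto simp: lattice_basis_def)
  define co where "co = (\<lambda>x. THE c :: real ^ 'n \<Rightarrow> int.
        (\<forall>b. b \<notin> B \<longrightarrow> c b = 0) \<and> x = (\<Sum>b\<in>B. of_int (c b) *\<^sub>R b))"
  have co: "(\<forall>b. b \<notin> B \<longrightarrow> co x b = 0) \<and> x = (\<Sum>b\<in>B. of_int (co x b) *\<^sub>R b)" if "x \<in> lattice" for x
    unfolding co_def using theI'[OF ex1[OF that]] .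
  have uniq: "c = c'" if "x \<in> lattice"
    "\<forall>b. b \<notin> B \<longrightarrow> c b = 0" "x = (\<Sum>b\<in>B. of_int (c b) *\<^sub>R b)"
    "\<forall>b. b \<notin> B \<longrightarrow> c' b = 0" "x = (\<Sum>b\<in>B. of_int (c' b) *\<^sub>R b)" for x and c c' :: "real ^ 'n \<Rightarrow> int"
    using ex1[OF that(1)] that by blast
  define f where "f = (\<lambda>b x. \<Sum>i\<in>UNIV. x $ i * of_int (co (axis i 1) b) :: real)"
  have lin: "linear (f b)" for b
    by (auto simp: f_def linear_iff sum.distrib sum_distrib_left algebra_simps)
  have expand: "x = (\<Sum>b\<in>B. f b x *\<^sub>R b)" for x
  proof -
    have "x = (\<Sum>i\<in>UNIV. x $ i *\<^sub>R axis i 1)" by (simp add: axis_expansion)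
    also have "\<dots> = (\<Sum>i\<in>UNIV. x $ i *\<^sub>R (\<Sum>b\<in>B. of_int (co (axis i 1) b) *\<^sub>R b))"
      by (intro sum.cong refl arg_cong2[where f = scaleR]) (use co axis_in_lattice in blast)
    also have "\<dots> = (\<Sum>b\<in>B. f b x *\<^sub>R b)"
      unfolding f_def scaleR_sum_right scaleR_sum_left by (subst sum.swap) simp
    finally show ?thesis .
  qed
  have int: "f b x \<in> \<int>" if "x \<in> lattice" for b x
    using that by (auto simp: f_def lattice_def intro!: Ints_sum Ints_mult)
  have dual: "f b b' = (if b = b' then 1 else 0)" if "b \<in> B" "b' \<in> B" for b b'
  proof -
    define c where "c = (\<lambda>b. if b \<in> B then \<lfloor>f b b'\<rfloor> else 0)"
    have b'L: "b' \<in> lattice" using BL that by auto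
    have "b' = (\<Sum>b\<in>B. of_int (c b) *\<^sub>R b)"
      using expand[of b'] int[OF b'L] by (simp add: c_def)
    then have c_eq: "c = (\<lambda>b. if b = b' then 1 else 0)"
      using that fin
      by (intro uniq[OF b'L]) (auto simp: c_def if_distrib[of of_int] if_distrib[of "\<lambda>t. t *\<^sub>R _"] cong: if_cong)
    then have "\<lfloor>f b b'\<rfloor> = (if b = b' then 1 else 0)" using fun_cong[OF c_eq, of b] that unfolding c_def by presburger
    moreover have "f b b' = of_int \<lfloor>f b b'\<rfloor>" using int[OF b'L] by simp
    ultimately show ?thesis by (simp split: if_splits)
  qed
  show ?thesis
    by (rule that[of f]) (use lin int dual expand[symmetric] in blast)+
qed

lemma linear_eq_zero_on_spanning:
  fixes f :: "real ^ 'n \<Rightarrow> real"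
  assumes "linear f" "span G = UNIV" "\<And>g. g \<in> G \<Longrightarrow> f g = 0"
  shows "f x = 0"
  using linear_eq_0_on_span[OF assms(1,3)] assms(2) by auto

text \<open>
  Let \<open>G\<close> be a set of minimal generators that generates \<open>\<tau>\<close>, and hence spans the whole space, and
  let \<open>B\<close> be a lattice basis containing \<open>Gen \<tau>\<close>.  If some \<open>b\<close> in \<open>B\<close> were outside \<open>G\<close>, its dual
  functional would vanish on \<open>G\<close> and so everywhere.  Thus \<open>G = Gen \<tau> = B\<close>.
\<close>

lemma nondegenerate_smooth_cone:
  fixes \<tau> :: "(real ^ 'n) set"
  assumes "rational_cone \<tau>" "nondegenerate \<tau>" "smooth_cone \<tau>"
  shows "lattice_basis (Gen \<tau>)" "\<tau> = convex_cone hull (Gen \<tau>)" "span (Gen \<tau>) = UNIV"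
proof -
  obtain G where G: "G \<subseteq> Gen \<tau>" "\<tau> = convex_cone hull G"
    using rational_cone_generated_by_Gen[OF assms(1)] .
  obtain B where B: "lattice_basis B" "Gen \<tau> \<subseteq> B" using assms(3) by (auto simp: smooth_cone_def)
  obtain f :: "real ^ 'n \<Rightarrow> real ^ 'n \<Rightarrow> real" where f: "\<forall>b. linear (f b)"
    "\<forall>b\<in>B. \<forall>b'\<in>B. f b b' = (if b = b' then 1 else 0)"
    by (rule lattice_basis_dual[OF B(1)]) (rule that)
  have "\<tau> \<subseteq> span G"
    unfolding G(2) by (rule hull_minimal) (auto simp: span_base convex_cone_span)
  moreover have "span \<tau> = UNIV"
    using assms(2) dim_eq_full[of \<tau>] by (simp add: nondegenerate_def)
  ultimately have spanG: "span G = UNIV"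
    by (metis span_mono span_span top.extremum_unique)
  have "B \<subseteq> G"
  proof (rule subsetI, rule ccontr)
    fix b assume b: "b \<in> B" "b \<notin> G"
    have "f b b = 0"
      by (rule linear_eq_zero_on_spanning[OF _ spanG, of "f b"]) (use b G B f in auto)
    then show False using f(2) b by simp
  qed
  then have "Gen \<tau> = B" "G = B" using G B by auto
  then show "lattice_basis (Gen \<tau>)" "\<tau> = convex_cone hull (Gen \<tau>)" "span (Gen \<tau>) = UNIV"
    using B G spanG by auto
qed

text \<open>
  The functional \<open>l\<^sub>\<tau>\<close> is the sum of the dual basis of \<open>Gen \<tau>\<close>, which is why it is integral.
\<close>

lemma gen_functional_linear:
  fixes \<tau> :: "(real ^ 'n) set"
  assumes "lattice_basis (Gen \<tau>)" "span (Gen \<tau>) = UNIV"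
  shows "linear (gen_functional \<tau>)" "\<And>v. v \<in> Gen \<tau> \<Longrightarrow> gen_functional \<tau> v = 1"
    "\<And>x. x \<in> lattice \<Longrightarrow> gen_functional \<tau> x \<in> \<int>"
proof -
  obtain f :: "real ^ 'n \<Rightarrow> real ^ 'n \<Rightarrow> real" where f: "\<forall>b. linear (f b)"
    "\<forall>b. \<forall>x\<in>lattice. f b x \<in> \<int>"
    "\<forall>b\<in>Gen \<tau>. \<forall>b'\<in>Gen \<tau>. f b b' = (if b = b' then 1 else 0)"
    by (rule lattice_basis_dual[OF assms(1)]) (rule that)
  have fin: "finite (Gen \<tau>)" using assms by (simp add: lattice_basis_def)
  define l where "l = (\<lambda>x. \<Sum>b\<in>Gen \<tau>. f b x)"
  have lin: "linear l" unfolding l_def using f(1) by (intro linear_compose_sum) auto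
  have one: "l v = 1" if "v \<in> Gen \<tau>" for v
    using that fin f(3) by (simp add: l_def)
  have uniq: "l' = l" if "linear l'" "\<forall>v\<in>Gen \<tau>. l' v = 1" for l'
  proof
    fix x
    have "(\<lambda>x. l' x - l x) x = 0"
      by (rule linear_eq_zero_on_spanning[OF linear_compose_sub[OF that(1) lin] assms(2)])
        (use that one in auto)
    then show "l' x = l x" by simp
  qed
  have int: "l x \<in> \<int>" if "x \<in> lattice" for x
    unfolding l_def using f(2) that by (intro Ints_sum) blast
  have "gen_functional \<tau> = l"
    unfolding gen_functional_def by (rule the_equality) (use lin one uniq in \<open>blast+\<close>)
  then show "linear (gen_functional \<tau>)" "\<And>v. v \<in> Gen \<tau> \<Longrightarrow> gen_functional \<tau> v = 1"
    "\<And>x. x \<in> lattice \<Longrightarrow> gen_functional \<tau> x \<in> \<int>"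
    using lin one int by simp_all
qed

section \<open>Covering by the nondegenerate cones of a subdivision\<close>

text \<open>
  If \<open>s\<close> missed the closed set covered by the nondegenerate cones, then a nonempty open part of
  the interior of \<open>\<sigma>\<close> near \<open>s\<close> would be covered by lower-dimensional cones, which are negligible.
\<close>

lemma subdivision_nondegenerate_cover:
  fixes \<sigma> :: "(real ^ 'n) set"
  assumes "subdivision \<sigma> \<Sigma>" "s \<in> closure (interior \<sigma>)"
  obtains \<tau> where "\<tau> \<in> \<Sigma>" "nondegenerate \<tau>" "s \<in> \<tau>"
proof -
  have fin: "finite \<Sigma>" and rat: "\<And>\<tau>. \<tau> \<in> \<Sigma> \<Longrightarrow> rational_cone \<tau>" and un: "\<Union>\<Sigma> = \<sigma>"
    using assms(1) by (auto simp: subdivision_def fan_def)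
  let ?D = "{\<tau> \<in> \<Sigma>. nondegenerate \<tau>}"
  have closed: "closed (\<Union>?D)"
    using fin rat closed_convex_cone_hull by (intro closed_Union) (auto simp: rational_cone_def)
  have "negligible \<tau>" if "\<tau> \<in> \<Sigma>" "\<not> nondegenerate \<tau>" for \<tau>
    using that dim_subset_UNIV[of \<tau>] by (intro negligible_lowdim) (auto simp: nondegenerate_def)
  then have neg: "negligible (\<Union>(\<Sigma> - ?D))" using fin by (intro negligible_Union) auto
  have "s \<in> \<Union>?D"
  proof (rule ccontr)
    assume "s \<notin> \<Union>?D"
    then have "interior \<sigma> \<inter> - \<Union>?D \<noteq> {}"
      using assms(2) closed open_Int_closure_eq_empty[of "- \<Union>?D" "interior \<sigma>"] by auto
    moreover have "interior \<sigma> \<inter> - \<Union>?D \<subseteq> \<Union>(\<Sigma> - ?D)" using interior_subset[of \<sigma>] un by blast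
    moreover have "open (interior \<sigma> \<inter> - \<Union>?D)" using closed by auto
    ultimately show False using neg negligible_subset open_not_negligible by blast
  qed
  then show ?thesis using that by blast
qed


section \<open>Cones over a coordinate facet\<close>

text \<open>
  The coordinate \<open>p\<close> plays the role of the last one, so that the cone is spanned by the coordinate
  facet \<open>x $ p = 0\<close> of the positive orthant and one vector \<open>v\<close> with positive integer coordinates.
\<close>

locale coordinate_facet_cone =
  fixes p :: "'n::finite" and \<alpha> :: "'n \<Rightarrow> int" and v :: "real ^ 'n" and \<sigma> :: "(real ^ 'n) set"
  assumes pos: "\<And>i. i \<noteq> p \<Longrightarrow> 0 < \<alpha> i" and apex_pos: "0 < \<alpha> p"
  defines "v \<equiv> (\<chi> i. real_of_int (\<alpha> i))"
  defines "\<sigma> \<equiv> convex_cone hull insert v ((\<lambda>i. axis i 1) ` (- {p}))"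
begin

lemma v_nth [simp]: "v $ i = of_int (\<alpha> i)"
  by (simp add: v_def)

text \<open>
  The inequalities say that the coefficients of \<open>x\<close> in the basis formed by \<open>v\<close> and the
  \<open>axis i 1\<close> are nonnegative: the coefficient of \<open>v\<close> is \<open>x $ p / \<alpha> p\<close>, and that of
  \<open>axis i 1\<close> is \<open>x $ i - (x $ p / \<alpha> p) * \<alpha> i\<close>.
\<close>

lemma cone_ineqs: "\<sigma> = {x. 0 \<le> x $ p \<and> (\<forall>i. i \<noteq> p \<longrightarrow> of_int (\<alpha> i) * x $ p \<le> of_int (\<alpha> p) * x $ i)}"
  (is "_ = ?H")
proof (rule antisym)
  show "\<sigma> \<subseteq> ?H"
    unfolding \<sigma>_def
  proof (rule hull_minimal)
    show "convex_cone ?H"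
      unfolding convex_cone_iff
    proof (intro conjI ballI allI impI)
      fix x y assume "x \<in> ?H" "y \<in> ?H"
      then show "x + y \<in> ?H" by (auto simp: distrib_left intro: add_mono)
    next
      fix x and c :: real assume x: "x \<in> ?H" and c: "0 \<le> c"
      have "of_int (\<alpha> i) * (c * x $ p) \<le> of_int (\<alpha> p) * (c * x $ i)" if "i \<noteq> p" for i
        using mult_left_mono[OF _ c, of "of_int (\<alpha> i) * x $ p" "of_int (\<alpha> p) * x $ i"] x that
        by (simp add: mult_ac)
      then show "c *\<^sub>R x \<in> ?H" using x c by simp
    qed auto
    show "insert v ((\<lambda>i. axis i 1) ` (- {p})) \<subseteq> ?H"
      using apex_pos by (auto simp: axis_def)
  qed
next
  show "?H \<subseteq> \<sigma>"
  proof
    fix x assume x: "x \<in> ?H"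
    define t where "t = x $ p / of_int (\<alpha> p)"
    have split: "x = t *\<^sub>R v + (\<Sum>i\<in>- {p}. (x $ i - t * of_int (\<alpha> i)) *\<^sub>R axis i 1)"
      using apex_pos by (auto simp: vec_eq_iff t_def axis_def if_distrib[of "\<lambda>t. _ * t"] cong: if_cong)
    have "(x $ i - t * of_int (\<alpha> i)) *\<^sub>R axis i 1 \<in> \<sigma>" if "i \<in> - {p}" for i
      unfolding \<sigma>_def
      using x that apex_pos
      by (intro convex_cone_hull_mul hull_inc) (auto simp: t_def field_simps)
    moreover have "(\<Sum>i\<in>I. g i) \<in> \<sigma>" if "\<And>i. i \<in> I \<Longrightarrow> g i \<in> \<sigma>" "finite I" for g and I :: "'n set"
      using that(2,1)
      by (induction I) (auto simp: \<sigma>_def convex_cone_hull_contains_0 convex_cone_hull_add)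
    ultimately have "(\<Sum>i\<in>- {p}. (x $ i - t * of_int (\<alpha> i)) *\<^sub>R axis i 1) \<in> \<sigma>"
      by (meson finite)
    moreover have "t *\<^sub>R v \<in> \<sigma>"
      unfolding \<sigma>_def using x apex_pos by (intro convex_cone_hull_mul hull_inc) (auto simp: t_def)
    ultimately show "x \<in> \<sigma>"
      by (subst split) (auto simp: \<sigma>_def intro: convex_cone_hull_add)
  qed
qed

lemma cone_nonneg: "x \<in> \<sigma> \<Longrightarrow> 0 \<le> x $ i"
proof (cases "i = p")
  case False
  assume x: "x \<in> \<sigma>"
  have "0 \<le> of_int (\<alpha> i) * x $ p"
    using x pos[OF False] by (simp add: cone_ineqs)
  also have "\<dots> \<le> of_int (\<alpha> p) * x $ i"
    using x False by (simp add: cone_ineqs)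
  finally show ?thesis using apex_pos by (simp add: zero_le_mult_iff)
qed (simp add: cone_ineqs)

lemma cone_pos:
  assumes "x \<in> \<sigma>" "0 < x $ p"
  shows "0 < x $ i"
proof (cases "i = p")
  case False
  have "0 < of_int (\<alpha> i) * x $ p"
    using assms pos[OF False] by simp
  also have "\<dots> \<le> of_int (\<alpha> p) * x $ i"
    using assms False by (simp add: cone_ineqs)
  finally show ?thesis using apex_pos by (simp add: zero_less_mult_iff)
qed (use assms in simp)

lemma pointed: "x \<in> \<sigma> \<Longrightarrow> - x \<in> \<sigma> \<Longrightarrow> x = 0"
  using cone_nonneg[of x] cone_nonneg[of "- x"] by (auto simp: vec_eq_iff intro: antisym)

text \<open>
  A generator is irredundant as soon as a linear functional is positive on it and nonpositive on
  the others.  For \<open>axis i 1\<close> this functional is the defining inequality with index \<open>i\<close>, and for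
  \<open>v\<close> it is the coordinate \<open>p\<close>.
\<close>

lemma ray_axis: "i \<noteq> p \<Longrightarrow> ray (axis i 1) \<in> rays \<sigma>"
proof -
  assume i: "i \<noteq> p"
  let ?S = "insert v ((\<lambda>i. axis i 1) ` (- {p} - {i}))"
  have eq: "\<sigma> = convex_cone hull insert (axis i 1) ?S"
    unfolding \<sigma>_def using i by (intro arg_cong[of _ _ "(hull) convex_cone"]) auto
  define u :: "real ^ 'n" where "u = of_int (\<alpha> p) *\<^sub>R axis i 1 - of_int (\<alpha> i) *\<^sub>R axis p 1"
  have u: "u \<bullet> x = of_int (\<alpha> p) * x $ i - of_int (\<alpha> i) * x $ p" for x
    by (simp add: u_def inner_diff_left inner_axis')
  have "convex_cone hull ?S \<subseteq> {x. u \<bullet> x \<le> 0}"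
    using i by (intro hull_minimal convex_cone_halfspace_le) (auto simp: u axis_def)
  moreover have "\<not> u \<bullet> axis i 1 \<le> 0" using i apex_pos by (simp add: u axis_def)
  ultimately have "axis i 1 \<notin> convex_cone hull ?S" by blast
  then show ?thesis unfolding eq by (intro irredundant_generator_ray) (use pointed eq in auto)
qed

lemma ray_v: "ray v \<in> rays \<sigma>"
proof -
  have p: "axis p 1 \<bullet> x = x $ p" for x :: "real ^ 'n"
    by (simp add: inner_axis')
  have "convex_cone hull ((\<lambda>i. axis i (1 :: real)) ` (- {p})) \<subseteq> {x. axis p 1 \<bullet> x \<le> 0}"
    by (intro hull_minimal convex_cone_halfspace_le) (unfold p, auto simp: axis_def)
  moreover have "\<not> axis p 1 \<bullet> v \<le> 0" using apex_pos by (simp add: p)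
  ultimately have "v \<notin> convex_cone hull ((\<lambda>i. axis i (1 :: real)) ` (- {p}))" by blast
  then show ?thesis unfolding \<sigma>_def by (intro irredundant_generator_ray) (use pointed \<sigma>_def in auto)
qed

text \<open>The point is approached from the interior along the direction of \<open>v\<close>.\<close>

lemma facet_point_in_closure_interior: "(\<Sum>i\<in>- {p}. axis i 1) \<in> closure (interior \<sigma>)"
proof -
  let ?s = "\<Sum>i\<in>- {p}. axis i (1::real)"
  let ?U = "{x :: real ^ 'n. 0 < x $ p \<and> (\<forall>i. i \<noteq> p \<longrightarrow> of_int (\<alpha> i) * x $ p < of_int (\<alpha> p) * x $ i)}"
  have s: "?s $ i = (if i = p then 0 else 1)" for i
    by (auto simp: axis_def if_distrib cong: if_cong)
  have U: "?U = {x. 0 < x $ p} \<inter> (\<Inter>i\<in>- {p}. {x. of_int (\<alpha> i) * x $ p < of_int (\<alpha> p) * x $ i})"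
    by auto
  have "open ?U"
    unfolding U by (intro open_Int open_INT ballI open_Collect_less continuous_intros) auto
  moreover have "?U \<subseteq> \<sigma>" by (auto simp: cone_ineqs less_imp_le)
  ultimately have U_int: "?U \<subseteq> interior \<sigma>" by (rule interior_maximal[rotated])
  have lim: "(\<lambda>n. ?s + (1 / real (Suc n)) *\<^sub>R v) \<longlonglongrightarrow> ?s + 0 *\<^sub>R v"
    by (intro tendsto_intros LIMSEQ_Suc lim_1_over_n)
  have "?s + (1 / real (Suc n)) *\<^sub>R v \<in> interior \<sigma>" for n
  proof (rule subsetD[OF U_int])
    have nth: "(?s + (1 / real (Suc n)) *\<^sub>R v) $ i
        = (if i = p then 0 else 1) + 1 / real (Suc n) * of_int (\<alpha> i)" for i
      unfolding vector_add_component s by simp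
    show "?s + (1 / real (Suc n)) *\<^sub>R v \<in> ?U"
      unfolding mem_Collect_eq nth using apex_pos by (simp add: algebra_simps)
  qed
  then show ?thesis
    unfolding closure_sequential using lim
    by (intro exI[of _ "\<lambda>n. ?s + (1 / real (Suc n)) *\<^sub>R v"]) simp
qed

text \<open>
  Expand \<open>s\<close>, the sum of the \<open>axis i 1\<close> with \<open>i \<noteq> p\<close>, in the basis \<open>B\<close>; the coefficients are
  nonnegative.  For each \<open>i\<close> some \<open>b\<close> with positive coefficient has \<open>b $ i > 0\<close>.  As \<open>s $ p = 0\<close>
  and all of \<open>\<sigma>\<close> has nonnegative coordinate \<open>p\<close>, also \<open>b $ p = 0\<close>.  Now \<open>l b = 1\<close> leaves no room
  for any other nonzero coordinate.
\<close>

lemma facet_generators: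
  assumes B: "lattice_basis B" "B \<subseteq> \<sigma>" and s: "(\<Sum>i\<in>- {p}. axis i 1) \<in> convex_cone hull B"
    and l: "linear (l :: _ \<Rightarrow> real)" "\<And>b. b \<in> B \<Longrightarrow> l b = 1" "\<And>i. i \<noteq> p \<Longrightarrow> 1 \<le> l (axis i 1)"
    and i: "i \<noteq> p"
  shows "axis i 1 \<in> B"
proof -
  let ?s = "\<Sum>i\<in>- {p}. axis i (1::real)"
  obtain f :: "real ^ 'n \<Rightarrow> real ^ 'n \<Rightarrow> real" where f_lin: "\<forall>b. linear (f b)"
    and f_dual: "\<forall>b\<in>B. \<forall>b'\<in>B. f b b' = (if b = b' then 1 else 0)"
    and f_expand: "\<forall>x. (\<Sum>b\<in>B. f b x *\<^sub>R b) = x"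
    by (rule lattice_basis_dual[OF B(1)]) (rule that)
  have fin: "finite B" and BL: "B \<subseteq> lattice" using B by (auto simp: lattice_basis_def)
  have "convex_cone hull B \<subseteq> {x. \<forall>b\<in>B. 0 \<le> f b x}"
    using f_lin f_dual
    by (intro hull_minimal) (auto simp: convex_cone_iff linear_add linear_scale linear_0)
  then have fs: "0 \<le> f b ?s" if "b \<in> B" for b using s that by auto
  have s_nth: "(\<Sum>b\<in>B. f b ?s * b $ j) = (if j = p then 0 else 1)" for j
  proof -
    have "(\<Sum>b\<in>B. f b ?s * b $ j) = (\<Sum>b\<in>B. f b ?s *\<^sub>R b) $ j" by simp
    also have "\<dots> = ?s $ j" using f_expand by simp
    finally show ?thesis by (auto simp: axis_def if_distrib cong: if_cong)
  qed
  obtain b where b: "b \<in> B" "0 < f b ?s * b $ i"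
  proof (rule ccontr)
    assume "\<not> thesis"
    then have "(\<Sum>b\<in>B. f b ?s * b $ i) \<le> 0" using that by (intro sum_nonpos) force
    then show False using i by (simp add: s_nth)
  qed
  have b_nonneg: "0 \<le> b $ j" for j using b B cone_nonneg by auto
  have "\<forall>b\<in>B. f b ?s * b $ p = 0"
    using s_nth[of p] fin fs B cone_nonneg by (subst sum_nonneg_eq_0_iff[symmetric]) auto
  then have bp: "b $ p = 0" using b by fastforce
  have bi: "1 \<le> b $ i"
    using b b_nonneg[of i] BL by (intro integral_lower_bound) (auto simp: lattice_def less_le)
  \<comment> \<open>The coordinates of \<open>b\<close> are nonnegative integers of sum at most \<open>l b = 1\<close>.\<close>
  have "(\<Sum>j\<in>UNIV. b $ j) \<le> (\<Sum>j\<in>UNIV. b $ j * l (axis j 1))"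
  proof (intro sum_mono)
    fix j show "b $ j \<le> b $ j * l (axis j 1)"
      using bp l(3)[of j] b_nonneg[of j] mult_left_mono[of 1 "l (axis j 1)" "b $ j"]
      by (cases "j = p") auto
  qed
  also have "\<dots> = l b"
    by (rule linear_axis_expansion[OF l(1), symmetric])
  also have "\<dots> = 1" using l b by simp
  finally have "(\<Sum>j\<in>UNIV. b $ j) \<le> 1" .
  then have le: "b $ i + (\<Sum>j\<in>- {i}. b $ j) \<le> 1"
    by (simp add: sum_UNIV_split_off[of _ i])
  have "0 \<le> (\<Sum>j\<in>- {i}. b $ j)" by (simp add: sum_nonneg b_nonneg)
  then have "b $ i = 1" "(\<Sum>j\<in>- {i}. b $ j) = 0" using bi le by auto
  then have "b $ i = 1" "\<forall>j\<in>- {i}. b $ j = 0" by (simp_all add: sum_nonneg_eq_0_iff b_nonneg)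
  then have "b = axis i 1" by (auto simp: vec_eq_iff axis_def)
  then show ?thesis using b by simp
qed

text \<open>
  In coordinates, \<open>l\<close> is the sum of the coordinates other than \<open>p\<close> plus \<open>l (axis p 1)\<close> times
  the coordinate \<open>p\<close>.  The hypothesis is what makes \<open>l v \<le> 0\<close> once
  \<open>l (axis p 1) \<le> 2 - CARD('n)\<close> is known.
\<close>

lemma no_moderate_toric_resolution:
  assumes sum_le: "(\<Sum>i\<in>- {p}. \<alpha> i) \<le> (int CARD('n) - 2) * \<alpha> p"
  shows "\<not> moderate_toric_resolution \<sigma> \<Sigma>"
proof
  assume "moderate_toric_resolution \<sigma> \<Sigma>"
  then have sub: "subdivision \<sigma> \<Sigma>" and mod: "\<And>\<tau>. \<tau> \<in> \<Sigma> \<Longrightarrow> nondegenerate \<tau> \<Longrightarrow> smooth_cone \<tau> \<and>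
        (\<forall>\<rho>\<in>rays \<sigma>. {x. gen_functional \<tau> x = 1} \<inter> \<rho> \<noteq> {})"
    by (auto simp: moderate_toric_resolution_def)
  let ?s = "\<Sum>i\<in>- {p}. axis i (1::real)"
  obtain \<tau> where \<tau>: "\<tau> \<in> \<Sigma>" "nondegenerate \<tau>" "?s \<in> \<tau>"
    using subdivision_nondegenerate_cover[OF sub facet_point_in_closure_interior] .
  have rat: "rational_cone \<tau>" and \<tau>\<sigma>: "\<tau> \<subseteq> \<sigma>"
    using sub \<tau> by (auto simp: subdivision_def fan_def)
  define B where "B = Gen \<tau>"
  define l where "l = gen_functional \<tau>"
  have B: "lattice_basis B" "\<tau> = convex_cone hull B" "span B = UNIV"
    using nondegenerate_smooth_cone[OF rat \<tau>(2)] mod[OF \<tau>(1,2)] by (auto simp: B_def)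
  have l: "linear l" "\<And>b. b \<in> B \<Longrightarrow> l b = 1" "\<And>x. x \<in> lattice \<Longrightarrow> l x \<in> \<int>"
    using gen_functional_linear[of \<tau>] B unfolding B_def l_def by blast+
  have B\<sigma>: "B \<subseteq> \<sigma>" using \<tau>\<sigma> B(2) hull_subset[of B] by blast
  have l_pos: "0 < l x" if "ray x \<in> rays \<sigma>" for x
  proof -
    have "{y. l y = 1} \<inter> ray x \<noteq> {}"
      unfolding l_def using mod[OF \<tau>(1,2)] that by blast
    then obtain t where "0 \<le> t" "l (t *\<^sub>R x) = 1" by (auto simp: ray_def)
    then have "0 < t * l x" "0 \<le> t" using l(1) by (auto simp: linear_scale)
    then show ?thesis by (simp add: zero_less_mult_iff)
  qed
  have l_axis: "1 \<le> l (axis i 1)" if "i \<noteq> p" for i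
    using l_pos[OF ray_axis[OF that]] l(3)[OF axis_in_lattice] by (rule integral_lower_bound[rotated])
  have axis_B: "axis i 1 \<in> B" if "i \<noteq> p" for i
    using facet_generators[OF B(1) B\<sigma> _ l(1,2) l_axis that] \<tau>(3) B(2) by simp
  obtain b where b: "b \<in> B" "b $ p \<noteq> 0"
  proof (rule ccontr)
    assume neg: "\<not> thesis"
    have "axis p 1 $ p = (0::real)"
      by (rule linear_eq_zero_on_spanning[OF _ B(3), of "\<lambda>x. x $ p"]) (use neg that in \<open>auto simp: linear_iff\<close>)
    then show False by simp
  qed
  have bL: "b \<in> lattice" using b B by (auto simp: lattice_basis_def)
  have bp: "1 \<le> b $ p"
    using b B\<sigma> cone_nonneg[of b p] bL by (intro integral_lower_bound) (auto simp: lattice_def)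
  have b_ge: "1 \<le> b $ i" for i
    using b B\<sigma> cone_pos[of b i] bL bp by (intro integral_lower_bound) (auto simp: lattice_def)
  \<comment> \<open>The functional dual to \<open>b\<close> vanishes on the coordinate facet, so its value 1 at \<open>b\<close> is a product
      of two positive integers, one of which is \<open>b $ p\<close>.\<close>
  have "b $ p = 1"
  proof -
    obtain f :: "real ^ 'n \<Rightarrow> real ^ 'n \<Rightarrow> real" where f_lin: "\<forall>b. linear (f b)"
      and f_int: "\<forall>b. \<forall>x\<in>lattice. f b x \<in> \<int>"
      and f_dual: "\<forall>b\<in>B. \<forall>b'\<in>B. f b b' = (if b = b' then 1 else 0)"
      by (rule lattice_basis_dual[OF B(1)]) (rule that)
    have zero: "f b (axis i 1) = 0" if "i \<noteq> p" for i
    proof -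
      have "b \<noteq> axis i 1" using b(2) that by (auto simp: axis_def)
      then show ?thesis using f_dual b(1) axis_B[OF that] by simp
    qed
    have "f b b = (\<Sum>i\<in>UNIV. b $ i * f b (axis i 1))"
      by (rule linear_axis_expansion) (use f_lin in blast)
    also have "\<dots> = b $ p * f b (axis p 1) + (\<Sum>i\<in>- {p}. b $ i * f b (axis i 1))"
      by (rule sum_UNIV_split_off)
    also have "(\<Sum>i\<in>- {p}. b $ i * f b (axis i 1)) = 0"
      by (intro sum.neutral ballI) (simp add: zero)
    finally have eq: "b $ p * f b (axis p 1) = 1" using f_dual b(1) by simp
    have "0 < f b (axis p 1)" by (rule zero_less_mult_pos[of "b $ p"]) (use eq bp in auto)
    then have "1 \<le> f b (axis p 1)" using f_int axis_in_lattice by (intro integral_lower_bound) auto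
    then have "b $ p * 1 \<le> b $ p * f b (axis p 1)" using bp by (intro mult_left_mono) auto
    then show ?thesis using bp eq by simp
  qed
  have l_eq: "l x = (\<Sum>i\<in>- {p}. x $ i) + x $ p * l (axis p 1)" for x
  proof -
    have "l x = (\<Sum>i\<in>UNIV. x $ i * l (axis i 1))" by (rule linear_axis_expansion[OF l(1)])
    also have "\<dots> = x $ p * l (axis p 1) + (\<Sum>i\<in>- {p}. x $ i * l (axis i 1))"
      by (rule sum_UNIV_split_off)
    also have "(\<Sum>i\<in>- {p}. x $ i * l (axis i 1)) = (\<Sum>i\<in>- {p}. x $ i)"
      by (intro sum.cong refl) (simp add: l(2)[OF axis_B])
    finally show ?thesis by simp
  qed
  have "card (- {p}) = CARD('n) - 1"
    unfolding Compl_eq_Diff_UNIV by (rule card_Diff_singleton) simp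
  then have "real (CARD('n) - 1) = (\<Sum>i\<in>- {p}. 1)" by simp
  also have "\<dots> \<le> (\<Sum>i\<in>- {p}. b $ i)" by (intro sum_mono b_ge)
  also have "\<dots> = 1 - l (axis p 1)" using l_eq[of b] l(2)[OF b(1)] \<open>b $ p = 1\<close> by simp
  finally have l_p: "l (axis p 1) \<le> 2 - real CARD('n)"
    by (simp add: of_nat_diff Suc_leI)
  have "l v = of_int (\<Sum>i\<in>- {p}. \<alpha> i) + of_int (\<alpha> p) * l (axis p 1)"
    using l_eq[of v] by simp
  also have "\<dots> \<le> of_int ((int CARD('n) - 2) * \<alpha> p) + of_int (\<alpha> p) * (2 - real CARD('n))"
  proof (intro add_mono mult_left_mono l_p)
    show "real_of_int (\<Sum>i\<in>- {p}. \<alpha> i) \<le> of_int ((int CARD('n) - 2) * \<alpha> p)"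
      using sum_le by (rule of_int_le_iff[THEN iffD2])
  qed (use apex_pos in simp)
  also have "\<dots> = 0" by (simp add: algebra_simps)
  finally show False using l_pos[OF ray_v] by simp
qed

end

section \<open>Nonexistence of a moderate toric resolution\<close>

text \<open>
  The first term is bounded by \<open>d - 2\<close> and each of the \<open>d - 2\<close> others, by integrality, by \<open>a d - 1\<close>.
\<close>

lemma head_bounded_sum_le:
  fixes a :: "nat \<Rightarrow> int"
  assumes "3 \<le> d" "\<And>i. 1 \<le> i \<Longrightarrow> i < d \<Longrightarrow> a i < a d" "a 1 \<le> int d - 2"
  shows "(\<Sum>i=1..d-1. a i) \<le> (int d - 2) * a d"
proof -
  have "(\<Sum>i=1..d-1. a i) = a 1 + (\<Sum>i=2..d-1. a i)"
    using assms(1) by (subst sum.atLeast_Suc_atMost) (auto simp: numeral_2_eq_2)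
  also have "\<dots> \<le> (int d - 2) + (\<Sum>i=2..d-1. a d - 1)"
  proof (intro add_mono sum_mono assms(3))
    fix i assume "i \<in> {2..d - 1}"
    then have "a i < a d" using assms(1) by (intro assms(2)) auto
    then show "a i \<le> a d - 1" by simp
  qed
  also have "\<dots> = (int d - 2) * a d"
    using assms(1) by (simp add: of_nat_diff algebra_simps)
  finally show ?thesis .
qed

theorem theorem1p6:
  fixes d :: nat and e :: "nat \<Rightarrow> 'n::finite" and a :: "nat \<Rightarrow> int"
    and \<sigma> :: "(real ^ 'n) set"
  assumes "3 \<le> d"
    and "bij_betw e {1..d} (UNIV :: 'n set)"
    and "\<forall>i. 1 \<le> i \<and> i < d - 1 \<longrightarrow> a i \<le> a (i + 1)"
    and "a (d - 1) < a d"
    and "1 \<le> a 1"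
    and "a 1 \<le> int d - 2"
    and "\<sigma> = convex_cone hull
               ((\<lambda>i. axis (e i) 1) ` {1..d - 1} \<union>
                {\<Sum>i=1..d. real_of_int (a i) *\<^sub>R axis (e i) 1})"
  shows "\<not> (\<exists>\<Sigma>. moderate_toric_resolution \<sigma> \<Sigma>)"
proof -
  define \<alpha> where "\<alpha> = (\<lambda>j. a (inv_into {1..d} e j))"
  have inj: "inj_on e {1..d}" and surj: "e ` {1..d} = UNIV"
    using assms(2) by (auto simp: bij_betw_def)
  have \<alpha>: "\<alpha> (e i) = a i" if "i \<in> {1..d}" for i
    using inj that by (simp add: \<alpha>_def)
  have compl: "- {e d} = e ` {1..d - 1}"
  proof -
    have "e ` ({1..d} - {d}) = e ` {1..d} - e ` {d}"
      using inj assms(1) by (intro inj_on_image_set_diff) auto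
    moreover have "{1..d} - {d} = {1..d - 1}" by auto
    ultimately show ?thesis using surj unfolding Compl_eq_Diff_UNIV by simp
  qed
  have mono: "a i \<le> a j" if "1 \<le> i" "i \<le> j" "j \<le> d - 1" for i j
    using that(2,1,3)
  proof (induction j rule: dec_induct)
    case (step n)
    then show ?case using assms(3)[rule_format, of n] by simp
  qed simp
  have lt: "a i < a d" if "1 \<le> i" "i < d" for i
    using mono[of i "d - 1"] assms(4) that by force
  have ge: "1 \<le> a i" if "1 \<le> i" "i < d" for i
    using mono[of 1 i] assms(5) that by force
  have ad: "1 \<le> a d" using ge[of 1] lt[of 1] assms(1) by simp
  interpret coordinate_facet_cone "e d" \<alpha> "\<chi> i. real_of_int (\<alpha> i)"
    "convex_cone hull insert (\<chi> i. real_of_int (\<alpha> i)) ((\<lambda>i. axis i 1) ` (- {e d}))"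
  proof unfold_locales
    show "0 < \<alpha> i" if "i \<noteq> e d" for i
    proof -
      have "i \<in> e ` {1..d - 1}" using that compl by auto
      then obtain k where "k \<in> {1..d - 1}" "i = e k" by auto
      then show ?thesis using ge[of k] \<alpha>[of k] assms(1) by fastforce
    qed
    show "0 < \<alpha> (e d)" using \<alpha>[of d] ad assms(1) by simp
  qed auto
  have "(\<Sum>i=1..d. real_of_int (a i) *\<^sub>R axis (e i) 1) = (\<Sum>j\<in>UNIV. real_of_int (\<alpha> j) *\<^sub>R axis j 1)"
    unfolding surj[symmetric] by (subst sum.reindex[OF inj]) (simp add: \<alpha>)
  also have "\<dots> = (\<chi> i. real_of_int (\<alpha> i))"
    using axis_expansion[of "\<chi> i. real_of_int (\<alpha> i)"] by simp
  finally have \<sigma>: "\<sigma> = convex_cone hull insert (\<chi> i. real_of_int (\<alpha> i)) ((\<lambda>i. axis i 1) ` (- {e d}))"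
    unfolding assms(7) compl image_image by simp
  have card: "CARD('n) = d"
    using card_image[OF inj] surj by simp
  have "(\<Sum>i\<in>- {e d}. \<alpha> i) = (\<Sum>i=1..d-1. a i)"
    unfolding compl
  proof (subst sum.reindex)
    show "inj_on e {1..d - 1}" by (rule inj_on_subset[OF inj]) auto
    show "sum (\<alpha> \<circ> e) {1..d - 1} = (\<Sum>i=1..d-1. a i)" by (intro sum.cong) (auto intro: \<alpha>)
  qed
  also have "\<dots> \<le> (int d - 2) * a d"
    using head_bounded_sum_le assms(1,6) lt by blast
  finally have "(\<Sum>i\<in>- {e d}. \<alpha> i) \<le> (int CARD('n) - 2) * \<alpha> (e d)"
    using assms(1) by (simp add: card \<alpha>)
  then show ?thesis using no_moderate_toric_resolution unfolding \<sigma> by blast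
qed

end
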